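(* Let $T$ be a tournament of order $n\geq 3$. Then $$h(T)=\binom{n}{2}-\delta^-_3(T)+2,$$ where $\delta^-_3(T)=\min\{d_T^-(x)+d_T^-(y)+d_T^-(w) : \{x,y,w\}\subseteq V(T)\text{ with } x,y,w \text{ distinct}\}$. Moreover, suppose the arcs of $T$ are colored with exactly $h(T)-1$ colors and $T$ has no heterochromatic out-directed spanning tree. Then there is a set of three distinct vertices $\{x,y,w\}\subseteq V(T)$ with the following properties: - $d_T^-(x)+d_T^-(y)+d_T^-(w)=\delta^-_3(T)$; - all the in-arcs of $x$, $y$ and $w$ receive one and the same color; - each of the remaining arcs of $T$ receives its own color, used on no other arc.
   Context: A tournament is a digraph $T$ such that for every pair of distinct vertices $x,y$ exactly one of $xy$, $yx$ is an arc. For a vertex $x$, $d_T^-(x)$ denotes its in-degree, and the in-arcs of $x$ are the arcs of the form $vx$. An out-directed spanning tree of $T$ is a spanning subdigraph $S$ whose underlying graph is a tree and which has a root $r$ such that for every vertex $u$, the unique $r$–$u$ path in $S$ is directed from $r$ to $u$. An arc-coloring of $T$ is a function $\Gamma: A(T)\to C$. It is a $k$-arc-coloring if $|\Gamma[A(T)]|=k$, i.e. it uses exactly $k$ colors. A subdigraph is heterochromatic if no two of its arcs receive the same color. $h(T)$ is the smallest integer $k$ such that every $k$-arc-coloring of $T$ yields at least one heterochromatic out-directed spanning tree of $T$. *)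

theory Defs
  imports Main
begin

definition tournament :: "'a set \<Rightarrow> ('a \<times> 'a) set \<Rightarrow> bool" where
  "tournament V A \<longleftrightarrow> finite V \<and> A \<subseteq> V \<times> V \<and> (\<forall>x. (x, x) \<notin> A) \<and>
     (\<forall>x\<in>V. \<forall>y\<in>V. x \<noteq> y \<longrightarrow> (((x, y) \<in> A) \<noteq> ((y, x) \<in> A)))"

definition indeg :: "('a \<times> 'a) set \<Rightarrow> 'a \<Rightarrow> nat" where
  "indeg A x = card {v. (v, x) \<in> A}"

definition delta3 :: "'a set \<Rightarrow> ('a \<times> 'a) set \<Rightarrow> nat" where
  "delta3 V A = Min {indeg A x + indeg A y + indeg A w | x y w.
      x \<in> V \<and> y \<in> V \<and> w \<in> V \<and> x \<noteq> y \<and> x \<noteq> w \<and> y \<noteq> w}"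

definition uadj :: "('a \<times> 'a) set \<Rightarrow> 'a \<Rightarrow> 'a \<Rightarrow> bool" where
  "uadj S u v \<longleftrightarrow> (u, v) \<in> S \<or> (v, u) \<in> S"

definition upath :: "('a \<times> 'a) set \<Rightarrow> 'a list \<Rightarrow> bool" where
  "upath S xs \<longleftrightarrow> xs \<noteq> [] \<and> distinct xs \<and> (\<forall>i. Suc i < length xs \<longrightarrow> uadj S (xs ! i) (xs ! Suc i))"

definition ucycle :: "('a \<times> 'a) set \<Rightarrow> 'a list \<Rightarrow> bool" where
  "ucycle S xs \<longleftrightarrow> length xs \<ge> 3 \<and> upath S xs \<and> uadj S (last xs) (hd xs)"

definition utree :: "'a set \<Rightarrow> ('a \<times> 'a) set \<Rightarrow> bool" where
  "utree V S \<longleftrightarrow> S \<subseteq> V \<times> V \<and>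
     (\<forall>u\<in>V. \<forall>v\<in>V. \<exists>xs. upath S xs \<and> hd xs = u \<and> last xs = v) \<and>
     (\<nexists>xs. ucycle S xs)"

definition dpath :: "('a \<times> 'a) set \<Rightarrow> 'a list \<Rightarrow> bool" where
  "dpath S xs \<longleftrightarrow> (\<forall>i. Suc i < length xs \<longrightarrow> (xs ! i, xs ! Suc i) \<in> S)"

definition out_tree :: "'a set \<Rightarrow> ('a \<times> 'a) set \<Rightarrow> ('a \<times> 'a) set \<Rightarrow> bool" where
  "out_tree V A S \<longleftrightarrow> S \<subseteq> A \<and> utree V S \<and>
     (\<exists>r\<in>V. \<forall>u\<in>V. \<forall>xs. upath S xs \<and> hd xs = r \<and> last xs = u \<longrightarrow> dpath S xs)"

definition heterochromatic :: "(('a \<times> 'a) \<Rightarrow> 'c) \<Rightarrow> ('a \<times> 'a) set \<Rightarrow> bool" where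
  "heterochromatic \<Gamma> S \<longleftrightarrow> inj_on \<Gamma> S"

text \<open>h(T): least k \<ge> 1 such that every k-arc-colouring (exactly k colours used) has a
  heterochromatic out-directed spanning tree. Colours are taken from nat (any finite colour
  set can be relabelled into nat).\<close>
definition h_num :: "'a set \<Rightarrow> ('a \<times> 'a) set \<Rightarrow> nat" where
  "h_num V A = (LEAST k. k \<ge> 1 \<and> (\<forall>\<Gamma> :: ('a \<times> 'a) \<Rightarrow> nat. card (\<Gamma> ` A) = k \<longrightarrow>
       (\<exists>S. out_tree V A S \<and> heterochromatic \<Gamma> S)))"

end

theory Submission
  imports Defs
begin

text \<open>
  Fix a colouring without a heterochromatic out-directed spanning tree and consider transversals \<open>D\<close>,
  which contain exactly one arc of each colour. A digraph without a spanning out-tree has two disjoint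
  nonempty vertex sets that no arc enters; let \<open>X, Y\<close> be such a pair for some \<open>D\<close>, with
  \<open>|X| + |Y|\<close> least over all transversals. An arc \<open>a\<close> between \<open>X\<close> and \<open>Y\<close> is missing from \<open>D\<close>;
  exchanging it for the arc \<open>a'\<close> of \<open>D\<close> of the same colour produces a third set \<open>Q\<close>, disjoint from
  both, which in \<open>D\<close> is entered by \<open>a'\<close> at most. Hence \<open>D\<close> misses all arcs entering \<open>X\<close>, \<open>Y\<close> or \<open>Q\<close>
  except possibly \<open>a'\<close>. A degree count shows that there are at least \<open>\<delta>\<close> such arcs, where \<open>\<delta>\<close> is the
  least in-degree sum of three vertices, and more than \<open>\<delta>\<close> unless the three sets are singletons. So
  at least \<open>\<delta> - 1\<close> arcs lie outside \<open>D\<close>. In case of equality further exchanges between the in-arcs of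
  the three vertices show that these all have one colour. Conversely, an out-tree contains in-arcs of
  at least two of any three vertices, so giving the in-arcs of an optimal triple one colour and every
  other arc its own leaves no heterochromatic out-tree.
\<close>

section \<open>Spanning out-trees\<close>

definition in_cut :: "('a \<times> 'a) set \<Rightarrow> 'a set \<Rightarrow> ('a \<times> 'a) set" where
  "in_cut D X = {a \<in> D. fst a \<notin> X \<and> snd a \<in> X}"

text \<open>If \<open>w\<close> already lies on the path, the path is cut there, so that no vertex
  repeats; otherwise \<open>w\<close> is appended.\<close>

lemma upath_trans_uadj:
  assumes "upath S xs" "hd xs = u" "last xs = v" "uadj S v w"
  shows "\<exists>ys. upath S ys \<and> hd ys = u \<and> last ys = w"
proof (cases "w \<in> set xs")
  case True
  then obtain i where i: "i < length xs" "xs ! i = w"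
    by (auto simp: in_set_conv_nth)
  have "upath S (take (Suc i) xs)" "hd (take (Suc i) xs) = u"
    using assms i by (auto simp: upath_def hd_take)
  moreover have "last (take (Suc i) xs) = w"
    using i by (simp add: take_Suc_conv_app_nth)
  ultimately show ?thesis by blast
next
  case False
  have ne: "xs \<noteq> []" using assms by (auto simp: upath_def)
  have "uadj S ((xs @ [w]) ! i) ((xs @ [w]) ! Suc i)" if "Suc i < length (xs @ [w])" for i
  proof (cases "Suc i < length xs")
    case True
    then show ?thesis using assms(1) by (simp add: upath_def nth_append)
  next
    case False
    then have "i = length xs - 1" using that by simp
    then have "(xs @ [w]) ! i = v" "(xs @ [w]) ! Suc i = w"
      using ne assms(3) by (simp_all add: nth_append last_conv_nth)
    then show ?thesis using assms(4) by simp
  qed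
  then have "upath S (xs @ [w])"
    using assms(1) False by (auto simp: upath_def)
  then show ?thesis using assms(2) ne by (intro exI[of _ "xs @ [w]"]) simp
qed

lemma upath_if_rtranclp:
  assumes "(uadj S)\<^sup>*\<^sup>* u v"
  shows "\<exists>xs. upath S xs \<and> hd xs = u \<and> last xs = v"
  using assms
proof (induction rule: rtranclp_induct)
  case base
  show ?case by (rule exI[of _ "[u]"]) (simp add: upath_def)
next
  case (step v w)
  then show ?case using upath_trans_uadj by metis
qed

text \<open>The decreasing \<open>depth\<close> excludes cycles: at a deepest vertex of a cycle both
  neighbours would be its only parent. Paths from \<open>r\<close> are directed because
  \<open>r\<close> has no in-arc and every other vertex has just one, so after an arc into a vertex
  the path can only leave it forwards.\<close>

lemma out_tree_of_parents:
  fixes depth :: "'a \<Rightarrow> nat"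
  assumes r: "r \<in> V"
    and parent: "\<And>v. v \<in> V - {r} \<Longrightarrow> p v \<in> V \<and> (p v, v) \<in> A \<and> depth (p v) < depth v"
  shows "out_tree V A ((\<lambda>v. (p v, v)) ` (V - {r}))"
proof -
  define S where "S = (\<lambda>v. (p v, v)) ` (V - {r})"
  have S: "(u, v) \<in> S \<longleftrightarrow> v \<in> V - {r} \<and> u = p v" for u v
    by (auto simp: S_def)
  have S_sub: "S \<subseteq> A" "S \<subseteq> V \<times> V"
    using parent by (auto simp: S_def)
  have sym: "uadj S u v \<Longrightarrow> uadj S v u" for u v by (auto simp: uadj_def)
  have from_root: "(uadj S)\<^sup>*\<^sup>* r v" if "v \<in> V" for v
    using that
  proof (induction "depth v" arbitrary: v rule: less_induct)
    case less
    show ?case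
    proof (cases "v = r")
      case False
      then have v: "p v \<in> V" "depth (p v) < depth v" using parent less.prems by auto
      have "uadj S (p v) v" using S False less.prems by (auto simp: uadj_def)
      then show ?thesis using less.hyps[OF v(2) v(1)] by simp
    qed simp
  qed
  have "symp (uadj S)" using sym by (simp add: symp_def)
  then have "symp (uadj S)\<^sup>*\<^sup>*" by (simp add: symp_rtranclp)
  then have conn: "(uadj S)\<^sup>*\<^sup>* u v" if "u \<in> V" "v \<in> V" for u v
    using from_root that by (meson rtranclp_trans sympD)
  have no_cycle: "\<not> ucycle S xs" for xs
  proof
    assume c: "ucycle S xs"
    let ?n = "length xs"
    have n: "?n \<ge> 3" and up: "upath S xs" and close: "uadj S (last xs) (hd xs)"
      using c by (auto simp: ucycle_def)
    have dist: "distinct xs" and ne: "xs \<noteq> []" using up by (auto simp: upath_def)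
    have adj: "uadj S (xs ! i) (xs ! (Suc i mod ?n))" if "i < ?n" for i
    proof (cases "Suc i < ?n")
      case True then show ?thesis using up by (simp add: upath_def)
    next
      case False
      then have "i = ?n - 1" "Suc i = ?n" using that by auto
      then show ?thesis using close ne by (simp add: last_conv_nth hd_conv_nth)
    qed
    let ?M = "Max ((\<lambda>i. depth (xs ! i)) ` {..<?n})"
    have "?M \<in> (\<lambda>i. depth (xs ! i)) ` {..<?n}" using ne by (intro Max_in) auto
    then obtain i where i: "i < ?n" "depth (xs ! i) = ?M" by auto
    have top: "depth (xs ! j) \<le> depth (xs ! i)" if "j < ?n" for j
      using that i(2) by simp
    have nb: "xs ! j = p (xs ! i)" if "uadj S (xs ! i) (xs ! j)" "j < ?n" for j
    proof -
      have "(xs ! i, xs ! j) \<notin> S"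
        using top[OF that(2)] parent[of "xs ! j"] by (auto simp: S)
      then show ?thesis using that(1) by (auto simp: uadj_def S)
    qed
    define j where "j = (if Suc i = ?n then 0 else Suc i)"
    define k where "k = (if i = 0 then ?n - 1 else i - 1)"
    have lt: "j < ?n" "k < ?n" and "j \<noteq> k" using i(1) n by (auto simp: j_def k_def)
    have "Suc k mod ?n = i" using i(1) n by (auto simp: k_def)
    then have "uadj S (xs ! i) (xs ! k)" using adj[OF lt(2)] sym by simp
    moreover have "Suc i mod ?n = j" using i(1) by (auto simp: j_def)
    then have "uadj S (xs ! i) (xs ! j)" using adj[OF i(1)] by simp
    ultimately have "xs ! j = xs ! k" using nb lt by metis
    then show False using dist lt \<open>j \<noteq> k\<close> by (simp add: nth_eq_iff_index_eq)
  qed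
  have directed: "dpath S xs" if up: "upath S xs" and hd: "hd xs = r" for xs
  proof -
    have "(xs ! i, xs ! Suc i) \<in> S" if "Suc i < length xs" for i
      using that
    proof (induction i)
      case 0
      have "uadj S (xs ! 0) (xs ! Suc 0)" "xs ! 0 = r"
        using up hd 0 by (auto simp: upath_def hd_conv_nth)
      then show ?case by (auto simp: uadj_def S)
    next
      case (Suc i)
      then have *: "(xs ! i, xs ! Suc i) \<in> S" by simp
      have "xs ! i \<noteq> xs ! Suc (Suc i)"
        using up Suc.prems by (simp add: upath_def nth_eq_iff_index_eq)
      then have "(xs ! Suc (Suc i), xs ! Suc i) \<notin> S" using * by (auto simp: S)
      moreover have "uadj S (xs ! Suc i) (xs ! Suc (Suc i))"
        using up Suc.prems by (simp add: upath_def)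
      ultimately show ?case by (auto simp: uadj_def)
    qed
    then show ?thesis by (simp add: dpath_def)
  qed
  have "utree V S"
    unfolding utree_def using S_sub no_cycle conn upath_if_rtranclp by metis
  then show ?thesis
    using S_sub r directed unfolding out_tree_def S_def by blast
qed

text \<open>Breadth-first search: \<open>depth\<close> is the distance from \<open>r\<close> in
  \<open>D\<close>, and the parent is a predecessor on a shortest path.\<close>

lemma out_tree_if_reachable:
  assumes D: "D \<subseteq> A" "D \<subseteq> V \<times> V" and r: "r \<in> V"
    and reach: "\<And>v. v \<in> V \<Longrightarrow> (r, v) \<in> D\<^sup>*"
  shows "\<exists>S \<subseteq> D. out_tree V A S"
proof -
  define depth where "depth v = (LEAST n. (r, v) \<in> D ^^ n)" for v
  have depth: "(r, v) \<in> D ^^ depth v" if "v \<in> V" for v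
    unfolding depth_def using reach[OF that] by (auto simp: rtrancl_power intro: LeastI)
  have "\<exists>u. u \<in> V \<and> (u, v) \<in> D \<and> depth u < depth v" if v: "v \<in> V - {r}" for v
  proof -
    obtain n where n: "depth v = Suc n"
      using depth[of v] v by (cases "depth v") auto
    then obtain u where u: "(r, u) \<in> D ^^ n" "(u, v) \<in> D"
      using depth[of v] v by auto
    have "depth u \<le> n" unfolding depth_def using u(1) by (rule Least_le)
    then show ?thesis using u D n by auto
  qed
  then obtain p where p: "\<And>v. v \<in> V - {r} \<Longrightarrow> p v \<in> V \<and> (p v, v) \<in> D \<and> depth (p v) < depth v"
    by metis
  have "out_tree V A ((\<lambda>v. (p v, v)) ` (V - {r}))"
    by (rule out_tree_of_parents[OF r, where depth = depth]) (use p D(1) in auto)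
  moreover have "(\<lambda>v. (p v, v)) ` (V - {r}) \<subseteq> D" using p by auto
  ultimately show ?thesis by blast
qed

text \<open>Ancestor sets are closed. Take \<open>r\<close> with the smallest one and
  \<open>v\<close> not reachable from \<open>r\<close>. A common ancestor \<open>z\<close> would
  have the same ancestors as \<open>r\<close>, so \<open>r\<close> would reach \<open>z\<close> and
  then \<open>v\<close>.\<close>

lemma out_tree_or_disjoint_closed:
  assumes D: "D \<subseteq> A" "D \<subseteq> V \<times> V" and V: "finite V" "V \<noteq> {}"
    and no: "\<nexists>S. S \<subseteq> D \<and> out_tree V A S"
  shows "\<exists>P Q. P \<subseteq> V \<and> Q \<subseteq> V \<and> P \<noteq> {} \<and> Q \<noteq> {} \<and> P \<inter> Q = {} \<and>
    in_cut D P = {} \<and> in_cut D Q = {}"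
proof -
  define anc where "anc v = {u \<in> V. (u, v) \<in> D\<^sup>*}" for v
  have closed: "in_cut D (anc v) = {}" for v
    using D unfolding in_cut_def anc_def by (auto intro: converse_rtrancl_into_rtrancl)
  have self: "v \<in> V \<Longrightarrow> v \<in> anc v" for v by (simp add: anc_def)
  obtain r where r: "r \<in> V" and min: "\<And>v. v \<in> V \<Longrightarrow> card (anc r) \<le> card (anc v)"
    using ex_has_least_nat[of "\<lambda>v. v \<in> V" _ "\<lambda>v. card (anc v)"] V by blast
  obtain v where v: "v \<in> V" "(r, v) \<notin> D\<^sup>*"
    using out_tree_if_reachable[OF D r] no by blast
  have "anc r \<inter> anc v = {}"
  proof (rule ccontr)
    assume "anc r \<inter> anc v \<noteq> {}"
    then obtain z where z: "z \<in> V" "(z, r) \<in> D\<^sup>*" "(z, v) \<in> D\<^sup>*"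
      by (auto simp: anc_def)
    have "anc z \<subseteq> anc r" using z by (auto simp: anc_def)
    moreover have "finite (anc r)" using V by (simp add: anc_def)
    ultimately have "anc z = anc r" using min[OF z(1)] by (simp add: card_seteq)
    then have "r \<in> anc z" using self r by simp
    then have "(r, v) \<in> D\<^sup>*" using z(3) by (auto simp: anc_def)
    then show False using v by simp
  qed
  then show ?thesis
    using closed self r v by (intro exI[of _ "anc r"] exI[of _ "anc v"]) (auto simp: anc_def)
qed

text \<open>This is all that the lower bound needs from an out-tree; the in-arc is the last arc of
  the path from the root.\<close>

lemma out_tree_in_arc:
  assumes "out_tree V A S"
  shows "\<exists>r. \<forall>v\<in>V. v \<noteq> r \<longrightarrow> (\<exists>u. (u, v) \<in> S)"
proof -
  obtain r where r: "r \<in> V"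
    and dp: "\<And>u xs. u \<in> V \<Longrightarrow> upath S xs \<Longrightarrow> hd xs = r \<Longrightarrow> last xs = u \<Longrightarrow> dpath S xs"
    using assms by (auto simp: out_tree_def)
  have "\<exists>u. (u, v) \<in> S" if v: "v \<in> V" "v \<noteq> r" for v
  proof -
    obtain xs where xs: "upath S xs" "hd xs = r" "last xs = v"
      using assms r v unfolding out_tree_def utree_def by blast
    have ne: "xs \<noteq> []" using xs by (simp add: upath_def)
    have len: "length xs \<ge> 2"
    proof (rule ccontr)
      assume "\<not> ?thesis"
      then have "hd xs = last xs" using ne by (cases xs) (auto simp: Suc_le_eq)
      then show False using xs v by simp
    qed
    have "(xs ! (length xs - 2), xs ! Suc (length xs - 2)) \<in> S"
      using dp[OF v(1) xs] len by (simp add: dpath_def)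
    moreover have "Suc (length xs - 2) = length xs - 1" using len by simp
    ultimately show ?thesis using xs(3) ne by (auto simp: last_conv_nth)
  qed
  then show ?thesis by blast
qed

section \<open>Cuts and in-degrees in tournaments\<close>

locale finite_tournament =
  fixes V :: "'a set" and A :: "('a \<times> 'a) set"
  assumes tournament: "tournament V A" and card_V: "card V \<ge> 3"
begin

definition into :: "'a set \<Rightarrow> ('a \<times> 'a) set" where
  "into S = {a \<in> A. snd a \<in> S}"

lemma finite_V: "finite V" and arcs_sub: "A \<subseteq> V \<times> V" and no_loop: "(x, x) \<notin> A"
  using tournament by (auto simp: tournament_def)

lemma finite_A: "finite A"
  using finite_V arcs_sub by (meson finite_SigmaI finite_subset)

lemma arc_or_arc: "x \<in> V \<Longrightarrow> y \<in> V \<Longrightarrow> x \<noteq> y \<Longrightarrow> (x, y) \<in> A \<or> (y, x) \<in> A"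
  using tournament unfolding tournament_def by blast

lemma not_both: "(x, y) \<in> A \<Longrightarrow> (y, x) \<notin> A"
  using tournament unfolding tournament_def by (metis mem_Sigma_iff subsetD)

lemma arc_ends: "(x, y) \<in> A \<Longrightarrow> x \<in> V \<and> y \<in> V \<and> x \<noteq> y"
  using arcs_sub no_loop by blast

lemma finite_into: "finite (into S)"
  using finite_A by (simp add: into_def)

lemma finite_in_cut: "finite (in_cut A S)"
  using finite_A by (simp add: in_cut_def)

lemma in_cut_singleton: "in_cut A {x} = into {x}"
  using no_loop by (auto simp: in_cut_def into_def)

lemma card_arcs_within:
  assumes "S \<subseteq> V"
  shows "2 * card (A \<inter> S \<times> S) = card S * (card S - 1)"
proof -
  have S: "finite S" using assms finite_V finite_subset by blast
  let ?B = "A \<inter> S \<times> S"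
  have "?B \<union> ?B\<inverse> = S \<times> S - Id" "?B \<inter> ?B\<inverse> = {}"
    using assms arc_or_arc not_both no_loop by blast+
  then have "card (S \<times> S - Id) = card ?B + card (?B\<inverse>)"
    using finite_A by (metis card_Un_disjoint finite_Int finite_converse)
  moreover have "S \<times> S - Id = S \<times> S - (\<lambda>x. (x, x)) ` S" by auto
  moreover have "card (S \<times> S - (\<lambda>x. (x, x)) ` S) = card S * card S - card S"
    using S by (subst card_Diff_subset) (auto simp: card_image inj_on_def card_cartesian_product)
  moreover have "card (?B\<inverse>) = card ?B" by (rule card_inverse)
  ultimately show ?thesis by (simp add: algebra_simps)
qed

lemma card_into:
  assumes "S \<subseteq> V"
  shows "card (into S) = (\<Sum>v\<in>S. indeg A v)"
proof -
  have S: "finite S" using assms finite_V finite_subset by blast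
  have "into S = (\<Union>v\<in>S. {a \<in> A. snd a = v})" by (auto simp: into_def)
  moreover have "card (\<Union>v\<in>S. {a \<in> A. snd a = v}) = (\<Sum>v\<in>S. card {a \<in> A. snd a = v})"
    using S finite_A by (intro card_UN_disjoint) auto
  moreover have "card {a \<in> A. snd a = v} = indeg A v" for v
  proof -
    have "{a \<in> A. snd a = v} = (\<lambda>u. (u, v)) ` {u. (u, v) \<in> A}" by auto
    then show ?thesis by (simp add: indeg_def card_image inj_on_def)
  qed
  ultimately show ?thesis by simp
qed

text \<open>In-arcs of vertices of \<open>S\<close> either lie inside \<open>S\<close>, one per
  pair, or belong to the cut. Doubling avoids division.\<close>

lemma sum_indeg:
  assumes "S \<subseteq> V"
  shows "2 * (\<Sum>v\<in>S. indeg A v) = card S * (card S - 1) + 2 * card (in_cut A S)"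
proof -
  have "into S = (A \<inter> S \<times> S) \<union> in_cut A S" "(A \<inter> S \<times> S) \<inter> in_cut A S = {}"
    by (auto simp: into_def in_cut_def)
  then have "card (into S) = card (A \<inter> S \<times> S) + card (in_cut A S)"
    using finite_A finite_in_cut by (simp add: card_Un_disjoint)
  then show ?thesis using card_arcs_within[OF assms] card_into[OF assms] by simp
qed

section \<open>Least in-degree sums of triples\<close>

lemma finite_triple_sums:
  "finite {indeg A x + indeg A y + indeg A w | x y w.
     x \<in> V \<and> y \<in> V \<and> w \<in> V \<and> x \<noteq> y \<and> x \<noteq> w \<and> y \<noteq> w}"
proof (rule finite_subset)
  show "finite ((\<lambda>(x, y, w). indeg A x + indeg A y + indeg A w) ` (V \<times> V \<times> V))"
    using finite_V by blast
qed force

lemma delta3_le: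
  assumes "x \<in> V" "y \<in> V" "w \<in> V" "x \<noteq> y" "x \<noteq> w" "y \<noteq> w"
  shows "delta3 V A \<le> indeg A x + indeg A y + indeg A w"
  unfolding delta3_def using assms by (intro Min_le[OF finite_triple_sums]) blast

lemma three_elements:
  assumes "finite S" "card S \<ge> 3"
  obtains x y w where "x \<in> S" "y \<in> S" "w \<in> S" "x \<noteq> y" "x \<noteq> w" "y \<noteq> w"
proof -
  obtain B where "B \<subseteq> S" "card B = 3" using obtain_subset_with_card_n assms(2) by metis
  then show ?thesis using that by (auto simp: card_3_iff)
qed

lemma delta3_attained:
  obtains x y w where "x \<in> V" "y \<in> V" "w \<in> V" "x \<noteq> y" "x \<noteq> w" "y \<noteq> w"
    "indeg A x + indeg A y + indeg A w = delta3 V A"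
proof -
  obtain x y w where "x \<in> V" "y \<in> V" "w \<in> V" "x \<noteq> y" "x \<noteq> w" "y \<noteq> w"
    using three_elements[OF finite_V card_V] .
  then have "{indeg A x + indeg A y + indeg A w | x y w.
      x \<in> V \<and> y \<in> V \<and> w \<in> V \<and> x \<noteq> y \<and> x \<noteq> w \<and> y \<noteq> w} \<noteq> {}" by blast
  from Min_in[OF finite_triple_sums this]
  show ?thesis using that unfolding delta3_def by (smt (verit) mem_Collect_eq)
qed

lemma card_into_triple:
  assumes "x \<in> V" "y \<in> V" "w \<in> V" "x \<noteq> y" "x \<noteq> w" "y \<noteq> w"
  shows "card (into {x, y, w}) = indeg A x + indeg A y + indeg A w"
  using assms by (simp add: card_into)

lemma delta3_ge_3: "delta3 V A \<ge> 3"
proof -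
  obtain x y w where *: "x \<in> V" "y \<in> V" "w \<in> V" "x \<noteq> y" "x \<noteq> w" "y \<noteq> w"
    "indeg A x + indeg A y + indeg A w = delta3 V A" by (rule delta3_attained)
  then show ?thesis using sum_indeg[of "{x, y, w}"] by simp
qed

text \<open>Replacing one vertex of an optimal triple by \<open>q\<close> cannot lower the
  sum.\<close>

lemma delta3_minimal_le:
  assumes "x \<in> V" "y \<in> V" "w \<in> V" "x \<noteq> y" "x \<noteq> w" "y \<noteq> w"
    and "indeg A x + indeg A y + indeg A w = delta3 V A"
    and "q \<in> V" "q \<notin> {x, y, w}"
  shows "indeg A x \<le> indeg A q" "indeg A y \<le> indeg A q" "indeg A w \<le> indeg A q"
  using assms delta3_le[of q y w] delta3_le[of x q w] delta3_le[of x y q] by auto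

text \<open>Four vertices span six arcs, so their in-degrees sum to at least 6; if \<open>q\<close>
  had in-degree at most 1, all four would.\<close>

lemma delta3_minimal_indeg_ge_2:
  assumes "x \<in> V" "y \<in> V" "w \<in> V" "x \<noteq> y" "x \<noteq> w" "y \<noteq> w"
    and "indeg A x + indeg A y + indeg A w = delta3 V A"
    and "q \<in> V" "q \<notin> {x, y, w}"
  shows "indeg A q \<ge> 2"
  using delta3_minimal_le[OF assms] sum_indeg[of "{x, y, w, q}"] assms by auto

text \<open>A triple of least in-degree sum inside \<^term>\<open>W\<close> has sum at most three times the in-degree of
  every other vertex of \<^term>\<open>W\<close>, so averaging over \<^term>\<open>W\<close> bounds \<^term>\<open>delta3 V A\<close>.\<close>

lemma card_mult_delta3_le:
  assumes "W \<subseteq> V" "card W \<ge> 3"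
  shows "card W * delta3 V A \<le> 3 * (\<Sum>v\<in>W. indeg A v)"
proof -
  let ?P = "\<lambda>(x, y, w). x \<in> W \<and> y \<in> W \<and> w \<in> W \<and> x \<noteq> y \<and> x \<noteq> w \<and> y \<noteq> w"
  have W: "finite W" using assms finite_V finite_subset by blast
  obtain x y w where "?P (x, y, w)"
    using three_elements[OF W assms(2)] by (metis (mono_tags, lifting) case_prod_conv)
  from ex_has_least_nat[of ?P, OF this, of "\<lambda>(x, y, w). indeg A x + indeg A y + indeg A w"]
  obtain x y w where P: "?P (x, y, w)"
    and min: "\<And>x' y' w'. ?P (x', y', w') \<Longrightarrow>
      indeg A x + indeg A y + indeg A w \<le> indeg A x' + indeg A y' + indeg A w'"
    by fastforce
  let ?s = "indeg A x + indeg A y + indeg A w"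
  have other: "?s \<le> 3 * indeg A v" if "v \<in> W - {x, y, w}" for v
    using that P min[of v y w] min[of x v w] min[of x y v] by auto
  have "(card W - 3) * ?s = (\<Sum>v\<in>W - {x, y, w}. ?s)"
    using P W by (simp add: card_Diff_subset numeral_3_eq_3)
  also have "\<dots> \<le> (\<Sum>v\<in>W - {x, y, w}. 3 * indeg A v)"
    by (rule sum_mono) (rule other)
  finally have "(card W - 3) * ?s \<le> 3 * (\<Sum>v\<in>W - {x, y, w}. indeg A v)"
    by (simp add: sum_distrib_left)
  moreover have "(\<Sum>v\<in>W. indeg A v) = (\<Sum>v\<in>W - {x, y, w}. indeg A v) + ?s"
    using P W by (subst sum.subset_diff[of "{x, y, w}"]) auto
  moreover have "card W * ?s = (card W - 3) * ?s + 3 * ?s"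
    using assms(2) by (metis add_mult_distrib le_add_diff_inverse2)
  ultimately have "card W * ?s \<le> 3 * (\<Sum>v\<in>W. indeg A v)" by simp
  moreover have "delta3 V A \<le> ?s" using P assms(1) by (intro delta3_le) auto
  ultimately show ?thesis by (meson le_trans mult_le_mono2)
qed

text \<open>Here \<open>i\<close> is the total size of the three cuts and \<open>d\<close> is
  \<open>delta3\<close>; integers avoid truncated subtraction. If \<open>d\<close> were at least
  \<open>i\<close>, the two bounds would combine to \<open>(2 * e + s) * (s - 3) \<le> 0\<close>,
  impossible for \<open>s > 3\<close>.\<close>

lemma triple_cut_arith:
  fixes a b c e i d :: int
  assumes abc: "a \<ge> 1" "b \<ge> 1" "c \<ge> 1" and e: "e \<ge> 0"
    and i: "2 * i = (a + b + c) * (a + b + c - 1) + 2 * e - a * (a - 1) - b * (b - 1) - c * (c - 1)"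
    and d: "(a + b + c) * (2 * d) \<le> 3 * ((a + b + c) * (a + b + c - 1) + 2 * e)"
    and big: "a + b + c > 3"
  shows "d < i"
proof (rule ccontr)
  assume "\<not> d < i"
  define s where "s = a + b + c"
  have "0 \<le> (a - 1) * (b - 1)" "0 \<le> (a - 1) * (c - 1)" "0 \<le> (b - 1) * (c - 1)"
    using abc by simp_all
  then have ab: "a * b + a * c + b * c \<ge> 2 * s - 3" unfolding s_def by (simp add: algebra_simps)
  have "i = e + (a * b + a * c + b * c)" using i by (simp add: algebra_simps)
  with ab have "d \<ge> e + 2 * s - 3" using \<open>\<not> d < i\<close> by simp
  then have "s * (2 * (e + 2 * s - 3)) \<le> s * (2 * d)"
    using big by (intro mult_left_mono) (auto simp: s_def)
  also have "\<dots> \<le> 3 * (s * (s - 1) + 2 * e)" using d by (simp add: s_def)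
  finally have "(2 * e + s) * (s - 3) \<le> 0" by (simp add: algebra_simps)
  moreover have "(2 * e + s) * (s - 3) > 0" using big e by (intro mult_pos_pos) (auto simp: s_def)
  ultimately show False by simp
qed

text \<open>With \<open>a, b, c\<close> the sizes of the three sets, \<open>s = a + b + c\<close> and \<open>e\<close> the number of arcs entering
  their union, the cuts contain \<open>e + ab + ac + bc \<ge> e + 2s - 3\<close> arcs, while averaging gives
  \<open>\<delta> \<le> 3(s - 1)/2 + 3e/s\<close>.\<close>

lemma disjoint_cuts:
  assumes sub: "X \<subseteq> V" "Y \<subseteq> V" "Z \<subseteq> V" and ne: "X \<noteq> {}" "Y \<noteq> {}" "Z \<noteq> {}"
    and disj: "X \<inter> Y = {}" "X \<inter> Z = {}" "Y \<inter> Z = {}"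
  shows "delta3 V A \<le> card (in_cut A X \<union> in_cut A Y \<union> in_cut A Z)"
    and "card (in_cut A X \<union> in_cut A Y \<union> in_cut A Z) \<le> delta3 V A \<Longrightarrow>
      \<exists>x y z. X = {x} \<and> Y = {y} \<and> Z = {z}"
proof -
  let ?W = "X \<union> Y \<union> Z" and ?I = "in_cut A X \<union> in_cut A Y \<union> in_cut A Z"
  have fin: "finite X" "finite Y" "finite Z" using sub finite_V finite_subset by blast+
  have pos: "card X \<ge> 1" "card Y \<ge> 1" "card Z \<ge> 1"
    using fin ne by (simp_all add: Suc_le_eq card_gt_0_iff)
  have W: "card ?W = card X + card Y + card Z"
    using fin disj by (simp add: card_Un_disjoint Int_Un_distrib2)
  have I: "card ?I = card (in_cut A X) + card (in_cut A Y) + card (in_cut A Z)"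
  proof -
    have "in_cut A X \<inter> in_cut A Y = {}" "(in_cut A X \<union> in_cut A Y) \<inter> in_cut A Z = {}"
      using disj by (auto simp: in_cut_def)
    then show ?thesis using finite_in_cut by (simp add: card_Un_disjoint)
  qed
  have sums: "(\<Sum>v\<in>?W. indeg A v) = (\<Sum>v\<in>X. indeg A v) + (\<Sum>v\<in>Y. indeg A v) + (\<Sum>v\<in>Z. indeg A v)"
    using fin disj by (simp add: sum.union_disjoint Int_Un_distrib2)
  have small: "\<exists>x y z. X = {x} \<and> Y = {y} \<and> Z = {z}" if "card ?W \<le> 3"
  proof -
    have "card X = 1" "card Y = 1" "card Z = 1" using that W pos by auto
    then show ?thesis by (meson card_1_singletonE)
  qed
  have large: "delta3 V A < card ?I" if big: "\<not> card ?W \<le> 3"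
  proof -
    have cast: "2 * (\<Sum>v\<in>S. int (indeg A v)) =
        int (card S) * (int (card S) - 1) + 2 * int (card (in_cut A S))"
      if S: "S \<subseteq> V" "card S \<ge> 1" for S
    proof -
      have "int (2 * (\<Sum>v\<in>S. indeg A v)) = int (card S * (card S - 1) + 2 * card (in_cut A S))"
        using sum_indeg[OF S(1)] by simp
      then show ?thesis using S(2) by (simp add: of_nat_diff)
    qed
    let ?a = "int (card X)" and ?b = "int (card Y)" and ?c = "int (card Z)"
    have cW: "2 * (\<Sum>v\<in>?W. int (indeg A v)) =
        (?a + ?b + ?c) * (?a + ?b + ?c - 1) + 2 * int (card (in_cut A ?W))"
      using cast[of ?W] W pos sub by simp
    have "int (card ?W * delta3 V A) \<le> int (3 * (\<Sum>v\<in>?W. indeg A v))"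
      using card_mult_delta3_le[of ?W] big sub by (simp del: of_nat_mult of_nat_sum)
    then have d: "(?a + ?b + ?c) * (2 * int (delta3 V A)) \<le>
        3 * ((?a + ?b + ?c) * (?a + ?b + ?c - 1) + 2 * int (card (in_cut A ?W)))"
      unfolding cW[symmetric] using W by (simp add: mult.commute)
    have "int (\<Sum>v\<in>?W. indeg A v) =
       int ((\<Sum>v\<in>X. indeg A v) + (\<Sum>v\<in>Y. indeg A v) + (\<Sum>v\<in>Z. indeg A v))"
      unfolding sums ..
    then have i: "2 * int (card ?I) = (?a + ?b + ?c) * (?a + ?b + ?c - 1) + 2 * int (card (in_cut A ?W))
        - ?a * (?a - 1) - ?b * (?b - 1) - ?c * (?c - 1)"
      using cW cast[of X] cast[of Y] cast[of Z] sub pos I by simp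
    have "int (delta3 V A) < int (card ?I)"
      by (rule triple_cut_arith[OF _ _ _ _ i d]) (use pos big W in auto)
    then show ?thesis by simp
  qed
  show "delta3 V A \<le> card ?I"
  proof (cases "card ?W \<le> 3")
    case True
    then obtain x y z where xyz: "X = {x}" "Y = {y}" "Z = {z}" using small by auto
    have "?I = into {x, y, z}" unfolding xyz in_cut_singleton by (auto simp: into_def)
    then show ?thesis
      using card_into_triple[of x y z] delta3_le[of x y z] xyz sub disj by auto
  next
    case False then show ?thesis using large by simp
  qed
  show "\<exists>x y z. X = {x} \<and> Y = {y} \<and> Z = {z}" if "card ?I \<le> delta3 V A"
    using that large small by (meson not_le)
qed

end

section \<open>Exchanges in transversals\<close>

text \<open>The bound on the colors says that there are at least
  \<open>card A - delta3 V A + 1\<close>, one less than the claimed value of \<open>h_num\<close>.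
  It thus serves both for the upper bound on \<open>h_num\<close> and for the structure of extremal
  colorings.\<close>

locale rainbow_free_coloring = finite_tournament V A
  for V :: "'a set" and A :: "('a \<times> 'a) set" +
  fixes \<Gamma> :: "'a \<times> 'a \<Rightarrow> 'c"
  assumes no_tree: "\<nexists>S. out_tree V A S \<and> heterochromatic \<Gamma> S"
    and many_colors: "card A + 1 \<le> card (\<Gamma> ` A) + delta3 V A"
begin

definition transversal :: "('a \<times> 'a) set \<Rightarrow> bool" where
  "transversal D \<longleftrightarrow> D \<subseteq> A \<and> inj_on \<Gamma> D \<and> \<Gamma> ` D = \<Gamma> ` A"

definition closed_pair :: "('a \<times> 'a) set \<Rightarrow> 'a set \<Rightarrow> 'a set \<Rightarrow> bool" where
  "closed_pair D X Y \<longleftrightarrow> X \<subseteq> V \<and> Y \<subseteq> V \<and> X \<noteq> {} \<and> Y \<noteq> {} \<and> X \<inter> Y = {} \<and>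
    in_cut D X = {} \<and> in_cut D Y = {}"

lemma transversal_closed_pair:
  assumes "transversal D"
  shows "\<exists>X Y. closed_pair D X Y"
proof -
  have "\<nexists>S. S \<subseteq> D \<and> out_tree V A S"
    using assms no_tree unfolding transversal_def heterochromatic_def by (meson inj_on_subset)
  moreover have "V \<noteq> {}" using card_V by auto
  ultimately show ?thesis
    using out_tree_or_disjoint_closed[of D A V] assms arcs_sub finite_V
    unfolding transversal_def closed_pair_def by fastforce
qed

lemma closed_pair_commute: "closed_pair D X Y \<Longrightarrow> closed_pair D Y X"
  by (auto simp: closed_pair_def)

lemma transversal_exchange:
  assumes D: "transversal D" and a: "a \<in> A" "a' \<in> D" "\<Gamma> a' = \<Gamma> a"
  shows "transversal (insert a (D - {a'}))"
proof -
  have "inj_on \<Gamma> (insert a (D - {a'}))"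
    using D a unfolding transversal_def inj_on_def by (metis Diff_iff insert_iff)
  moreover have "\<Gamma> ` insert a (D - {a'}) = \<Gamma> ` D"
    using a(2,3) by (metis image_insert insert_Diff)
  ultimately show ?thesis using D a by (auto simp: transversal_def)
qed

lemma partner:
  assumes "transversal D" "a \<in> A"
  obtains a' where "a' \<in> D" "\<Gamma> a' = \<Gamma> a"
  using assms unfolding transversal_def by (metis imageE imageI)

lemma card_complement:
  assumes "transversal D"
  shows "card (A - D) + 1 \<le> delta3 V A"
proof -
  have "card D = card (\<Gamma> ` A)" using assms by (metis card_image transversal_def)
  moreover have "card (A - D) + card D = card A"
    using assms finite_A by (metis add.commute card_Diff_subset card_mono finite_subset
        le_add_diff_inverse transversal_def)
  ultimately show ?thesis using many_colors by simp
qed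

text \<open>All three cuts would lie in \<open>A - D\<close>, which has fewer than
  \<open>delta3 V A\<close> arcs, contrary to \<open>disjoint_cuts\<close>.\<close>

lemma no_closed_triple:
  assumes D: "transversal D" and "X \<subseteq> V" "Y \<subseteq> V" "Z \<subseteq> V" "X \<noteq> {}" "Y \<noteq> {}" "Z \<noteq> {}"
    and "X \<inter> Y = {}" "X \<inter> Z = {}" "Y \<inter> Z = {}"
    and "in_cut D X = {}" "in_cut D Y = {}" "in_cut D Z = {}"
  shows False
proof -
  have "in_cut A X \<union> in_cut A Y \<union> in_cut A Z \<subseteq> A - D"
    using assms(11-13) unfolding in_cut_def by blast
  then have "card (in_cut A X \<union> in_cut A Y \<union> in_cut A Z) \<le> card (A - D)"
    using finite_A by (intro card_mono) auto
  then show False using disjoint_cuts(1)[OF assms(2-10)] card_complement[OF D] by simp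
qed

text \<open>With \<open>a\<close> added, \<open>A - D\<close> has at most \<open>delta3 V A\<close>
  arcs and the cuts have at least that many, so equality holds throughout.\<close>

lemma nearly_closed_triple:
  assumes D: "transversal D" and XYZ: "X \<subseteq> V" "Y \<subseteq> V" "Z \<subseteq> V" "X \<noteq> {}" "Y \<noteq> {}" "Z \<noteq> {}"
    "X \<inter> Y = {}" "X \<inter> Z = {}" "Y \<inter> Z = {}"
    and a: "a \<in> D" and sub: "in_cut A X \<union> in_cut A Y \<union> in_cut A Z \<subseteq> insert a (A - D)"
  shows "\<exists>x y z. X = {x} \<and> Y = {y} \<and> Z = {z} \<and> into {x, y, z} = insert a (A - D) \<and>
    indeg A x + indeg A y + indeg A z = delta3 V A"
proof -
  let ?I = "in_cut A X \<union> in_cut A Y \<union> in_cut A Z"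
  have fin: "finite (insert a (A - D))" using finite_A by simp
  have le: "card (insert a (A - D)) \<le> delta3 V A"
    using card_complement[OF D] finite_A a by simp
  have "card ?I \<le> card (insert a (A - D))" using fin sub by (rule card_mono)
  with le have "card ?I \<le> delta3 V A" by simp
  from disjoint_cuts(2)[OF XYZ this] obtain x y z where xyz: "X = {x}" "Y = {y}" "Z = {z}"
    by blast
  have eq: "?I = insert a (A - D)" "card ?I = delta3 V A"
    using disjoint_cuts(1)[OF XYZ] le sub fin card_seteq[OF fin sub] \<open>card ?I \<le> delta3 V A\<close>
    by auto
  have "?I = into {x, y, z}" unfolding xyz in_cut_singleton by (auto simp: into_def)
  then show ?thesis using eq xyz XYZ card_into_triple[of x y z] by auto
qed

section \<open>Closed pairs of least total size\<close>

definition minimal_pair :: "('a \<times> 'a) set \<Rightarrow> 'a set \<Rightarrow> 'a set \<Rightarrow> bool" where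
  "minimal_pair D X Y \<longleftrightarrow> transversal D \<and> closed_pair D X Y \<and>
    (\<forall>D' X' Y'. transversal D' \<longrightarrow> closed_pair D' X' Y' \<longrightarrow>
      card X + card Y \<le> card X' + card Y')"

lemma minimal_pair_commute: "minimal_pair D X Y \<Longrightarrow> minimal_pair D Y X"
  using closed_pair_commute by (auto simp: minimal_pair_def add.commute)

text \<open>Exchange \<open>(v, x)\<close> for the arc \<open>a'\<close> of \<open>D\<close> with the same colour. In the new transversal there are two
  disjoint closed sets, and one of them, \<open>P\<close>, avoids the head of \<open>a'\<close>, hence is already closed in \<open>D\<close>
  together with \<open>(v, x)\<close>. Minimality forces \<open>P\<close> to swallow \<open>Y\<close> and the other set to avoid \<open>X\<close>.\<close>

lemma third_closed_set:
  assumes mp: "minimal_pair D X Y" and vx: "(v, x) \<in> A" "v \<in> Y" "x \<in> X"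
  shows "\<exists>Q a'. Q \<subseteq> V \<and> Q \<noteq> {} \<and> X \<inter> Q = {} \<and> Y \<inter> Q = {} \<and> a' \<in> D \<and> \<Gamma> a' = \<Gamma> (v, x) \<and>
    in_cut A X \<union> in_cut A Y \<union> in_cut A Q \<subseteq> insert a' (A - D)"
proof -
  have D: "transversal D" and XY: "closed_pair D X Y"
    and min: "\<And>D' X' Y'. transversal D' \<Longrightarrow> closed_pair D' X' Y' \<Longrightarrow>
      card X + card Y \<le> card X' + card Y'"
    using mp by (auto simp: minimal_pair_def)
  obtain a' where a': "a' \<in> D" "\<Gamma> a' = \<Gamma> (v, x)" using partner[OF D vx(1)] .
  define D' where "D' = insert (v, x) (D - {a'})"
  have D': "transversal D'" unfolding D'_def using transversal_exchange[OF D vx(1) a'] .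
  have XY': "X \<subseteq> V" "Y \<subseteq> V" "X \<noteq> {}" "Y \<noteq> {}" "X \<inter> Y = {}" "in_cut D X = {}" "in_cut D Y = {}"
    using XY by (auto simp: closed_pair_def)
  have fin: "finite X" "finite Y" using XY' finite_V finite_subset by blast+
  \<comment> \<open>The head of \<open>a'\<close> lies in at most one of two disjoint sets; the
    names are chosen so that \<open>P\<close> avoids it.\<close>
  obtain P Q where PQ: "closed_pair D' P Q" and head: "snd a' \<notin> P"
    using transversal_closed_pair[OF D'] closed_pair_commute unfolding closed_pair_def
    by (metis disjoint_iff)
  have PQ': "P \<subseteq> V" "Q \<subseteq> V" "P \<noteq> {}" "Q \<noteq> {}" "P \<inter> Q = {}" "in_cut D' P = {}" "in_cut D' Q = {}"
    using PQ by (auto simp: closed_pair_def)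
  have P_closed: "in_cut (insert (v, x) D) P = {}"
    using PQ'(6) head unfolding in_cut_def D'_def by blast
  have P_closed_D: "in_cut D P = {}" using P_closed by (auto simp: in_cut_def)
  \<comment> \<open>Closed sets are stable under intersection, so a proper nonempty part of
    \<open>X\<close> would give a smaller closed pair.\<close>
  have X_sub: "X \<subseteq> P" if "P \<inter> X \<noteq> {}"
  proof -
    have "closed_pair D (P \<inter> X) Y"
      using XY' that P_closed_D by (auto simp: closed_pair_def in_cut_def)
    from min[OF D this] have "card X \<le> card (P \<inter> X)" by simp
    then show ?thesis using card_seteq[of X "P \<inter> X"] fin by auto
  qed
  have Y_sub: "Y \<subseteq> P" if "P \<inter> Y \<noteq> {}"
  proof -
    have "closed_pair D X (P \<inter> Y)"
      using XY' that P_closed_D by (auto simp: closed_pair_def in_cut_def)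
    from min[OF D this] have "card Y \<le> card (P \<inter> Y)" by simp
    then show ?thesis using card_seteq[of Y "P \<inter> Y"] fin by auto
  qed
  have "P \<inter> Y \<noteq> {}"
  proof
    assume *: "P \<inter> Y = {}"
    have "P \<inter> X \<noteq> {}"
      using no_closed_triple[OF D XY'(1,2) PQ'(1) XY'(3,4) PQ'(3) XY'(5) _ _ XY'(6,7) P_closed_D] *
      by (auto simp: Int_commute)
    then have "x \<in> P" using X_sub vx by auto
    then have "v \<in> P" using P_closed by (auto simp: in_cut_def)
    then show False using * vx by auto
  qed
  then have QY: "Y \<inter> Q = {}" using Y_sub PQ' by blast
  \<comment> \<open>Otherwise \<open>X \<inter> Q\<close> and \<open>Y\<close> are closed in
    \<open>D'\<close>: the new arc \<open>(v, x)\<close> starts in \<open>Y\<close>, which misses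
    \<open>Q\<close>. Minimality then puts \<open>x\<close>, hence also \<open>v\<close>, into
    \<open>Q\<close>.\<close>
  have QX: "X \<inter> Q = {}"
  proof (rule ccontr)
    assume "X \<inter> Q \<noteq> {}"
    moreover have "in_cut D' Y = {}"
      using XY'(5,7) vx by (auto simp: in_cut_def D'_def)
    moreover have "r \<in> X \<inter> Q" if rs: "(r, s) \<in> D'" "s \<in> X \<inter> Q" for r s
    proof -
      have "r \<in> Q" using PQ'(7) rs by (auto simp: in_cut_def)
      then have "(r, s) \<in> D" using rs QY vx by (auto simp: D'_def)
      then show ?thesis using XY'(6) rs \<open>r \<in> Q\<close> by (auto simp: in_cut_def)
    qed
    then have "in_cut D' (X \<inter> Q) = {}" by (auto simp: in_cut_def)
    ultimately have "closed_pair D' (X \<inter> Q) Y" using XY' by (auto simp: closed_pair_def)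
    from min[OF D' this] have "card X \<le> card (X \<inter> Q)" by simp
    then have "x \<in> Q" using card_seteq[of X "X \<inter> Q"] fin vx by auto
    then have "v \<in> Q" using PQ'(7) by (auto simp: in_cut_def D'_def)
    then show False using QY vx by auto
  qed
  have "in_cut A X \<subseteq> A - D" "in_cut A Y \<subseteq> A - D"
    using XY'(6,7) unfolding in_cut_def by blast+
  moreover have "in_cut A Q \<subseteq> insert a' (A - D)"
    using PQ'(7) unfolding in_cut_def D'_def by blast
  ultimately have "in_cut A X \<union> in_cut A Y \<union> in_cut A Q \<subseteq> insert a' (A - D)" by blast
  then show ?thesis using QX QY PQ' a' by blast
qed

lemma minimal_closed_pair_singletons:
  assumes mp: "minimal_pair D X Y" and vx: "(v, x) \<in> A" "v \<in> Y" "x \<in> X"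
  shows "\<exists>w a'. X = {x} \<and> Y = {v} \<and> w \<in> V \<and> w \<noteq> x \<and> w \<noteq> v \<and> a' \<in> D \<and> \<Gamma> a' = \<Gamma> (v, x) \<and>
    into {v, x, w} = insert a' (A - D) \<and> indeg A v + indeg A x + indeg A w = delta3 V A"
proof -
  have D: "transversal D" and XY: "closed_pair D X Y" using mp by (auto simp: minimal_pair_def)
  obtain Q a' where Q: "Q \<subseteq> V" "Q \<noteq> {}" "X \<inter> Q = {}" "Y \<inter> Q = {}"
    and a': "a' \<in> D" "\<Gamma> a' = \<Gamma> (v, x)"
    and sub: "in_cut A X \<union> in_cut A Y \<union> in_cut A Q \<subseteq> insert a' (A - D)"
    using third_closed_set[OF assms] by blast
  have XY': "X \<subseteq> V" "Y \<subseteq> V" "X \<noteq> {}" "Y \<noteq> {}" "X \<inter> Y = {}"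
    using XY by (auto simp: closed_pair_def)
  obtain x' y w where *: "X = {x'}" "Y = {y}" "Q = {w}" "into {x', y, w} = insert a' (A - D)"
    "indeg A x' + indeg A y + indeg A w = delta3 V A"
    using nearly_closed_triple[OF D XY'(1,2) Q(1) XY'(3,4) Q(2) XY'(5) Q(3,4) a'(1) sub] by blast
  then have "x' = x" "y = v" using vx by auto
  then show ?thesis using * Q a' by (intro exI[of _ w] exI[of _ a']) (auto simp: insert_commute)
qed

section \<open>Extremal triples and the colors of their in-arcs\<close>

definition extremal :: "'a \<Rightarrow> 'a \<Rightarrow> 'a \<Rightarrow> 'c \<Rightarrow> bool" where
  "extremal x y w c \<longleftrightarrow> x \<in> V \<and> y \<in> V \<and> w \<in> V \<and> x \<noteq> y \<and> x \<noteq> w \<and> y \<noteq> w \<and>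
    indeg A x + indeg A y + indeg A w = delta3 V A \<and>
    (\<forall>u \<in> into {x, y, w}. \<Gamma> u = c \<longrightarrow> transversal (insert u (A - into {x, y, w})))"

text \<open>The symmetry comes from quantifying over all in-arcs of color \<open>c\<close> instead
  of fixing one; exchanges may then pick any of them as representative.\<close>

lemma extremal_swap: "extremal x y w c \<Longrightarrow> extremal y x w c"
  and extremal_rotate: "extremal x y w c \<Longrightarrow> extremal y w x c"
  by (auto simp: extremal_def insert_commute)

text \<open>The singletons obtained from a minimal pair form the triple. Equality in the count also
  fixes the number of colors, which yields the upper bound on \<open>h_num\<close>.\<close>

lemma extremal_exists:
  "\<exists>x y w c. extremal x y w c \<and> (y, x) \<in> A \<and> \<Gamma> (y, x) = c \<and>
     card A + 1 = card (\<Gamma> ` A) + delta3 V A"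
proof -
  let ?P = "\<lambda>(D, X, Y). transversal D \<and> closed_pair D X Y"
  obtain D where D: "D \<subseteq> A" "inj_on \<Gamma> D" "\<Gamma> ` D = \<Gamma> ` A"
    using subset_image_inj[of "\<Gamma> ` A" \<Gamma> A] by auto
  then have "transversal D" by (simp add: transversal_def)
  moreover from transversal_closed_pair[OF this] obtain X Y where "closed_pair D X Y" by blast
  ultimately have "?P (D, X, Y)" by simp
  from ex_has_least_nat[of ?P, OF this, of "\<lambda>(D, X, Y). card X + card Y"]
  obtain D X Y where mp: "minimal_pair D X Y"
    by (fastforce simp: minimal_pair_def)
  obtain X Y v x where mp: "minimal_pair D X Y" and vx: "(v, x) \<in> A" "v \<in> Y" "x \<in> X"
  proof -
    obtain p q where pq: "p \<in> X" "q \<in> Y" "p \<in> V" "q \<in> V" "p \<noteq> q"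
      using mp unfolding minimal_pair_def closed_pair_def by blast
    then have "(q, p) \<in> A \<or> (p, q) \<in> A" using arc_or_arc by blast
    then show ?thesis using that mp minimal_pair_commute pq by meson
  qed
  have D: "transversal D" using mp by (simp add: minimal_pair_def)
  obtain w a' where w: "w \<in> V" "w \<noteq> x" "w \<noteq> v" and a': "a' \<in> D" "\<Gamma> a' = \<Gamma> (v, x)"
    and into: "into {v, x, w} = insert a' (A - D)"
    and deg: "indeg A v + indeg A x + indeg A w = delta3 V A"
    using minimal_closed_pair_singletons[OF mp vx] by blast
  have DA: "D \<subseteq> A" using D by (simp add: transversal_def)
  have eq: "D - {a'} = A - into {v, x, w}" using into DA a' by auto
  have v_x: "v \<in> V" "x \<in> V" "v \<noteq> x" using arc_ends[OF vx(1)] by auto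
  have "extremal x v w (\<Gamma> (v, x))"
    unfolding extremal_def
    using transversal_exchange[OF D _ a'(1)] a'(2) w v_x deg eq
    by (auto simp: insert_commute into_def)
  moreover have "card A + 1 = card (\<Gamma> ` A) + delta3 V A"
  proof -
    have "delta3 V A = card (insert a' (A - D))"
      using into card_into_triple[of v x w] deg v_x w by simp
    then have "delta3 V A = card (A - D) + 1" using finite_A a' by simp
    moreover have "card D = card (\<Gamma> ` A)" using D by (metis card_image transversal_def)
    moreover have "card (A - D) + card D = card A"
      using DA finite_A by (metis add.commute card_Diff_subset card_mono finite_subset
          le_add_diff_inverse)
    ultimately show ?thesis by simp
  qed
  ultimately show ?thesis using vx by blast
qed

lemma indeg_le_1:
  assumes "q \<in> V" "into {q} \<subseteq> {a}"
  shows "indeg A q \<le> 1"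
  using assms card_into[of "{q}"] card_mono[of "{a}" "into {q}"] by simp

text \<open>In \<open>A - into {x, y, w} \<union> {u}\<close> the singletons \<open>{y}\<close> and \<open>{w}\<close> are closed, so the exchange argument
  applies to the arc between them; the third closed set it yields must again be \<open>{x}\<close>.\<close>

lemma opposite_arc_color_aux:
  assumes ext: "extremal x y w c" and u: "u \<in> into {x}" "\<Gamma> u = c" and f: "(y, w) \<in> A"
  shows "\<Gamma> (y, w) = c"
proof -
  define D where "D = insert u (A - into {x, y, w})"
  have xyw: "x \<in> V" "y \<in> V" "w \<in> V" "x \<noteq> y" "x \<noteq> w" "y \<noteq> w"
    and deg: "indeg A x + indeg A y + indeg A w = delta3 V A"
    using ext by (auto simp: extremal_def)
  have D: "transversal D" using ext u unfolding extremal_def D_def into_def by blast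
  have "closed_pair D {w} {y}"
    using xyw u by (auto simp: closed_pair_def D_def in_cut_def into_def)
  \<comment> \<open>Two nonempty sets have total size at least 2, so a closed pair of singletons is
    minimal.\<close>
  moreover have "card {w} + card {y} \<le> card X' + card Y'" if "closed_pair D' X' Y'" for D' X' Y'
  proof -
    have "finite X'" "finite Y'" "X' \<noteq> {}" "Y' \<noteq> {}"
      using that finite_V finite_subset unfolding closed_pair_def by blast+
    then have "card X' \<ge> 1" "card Y' \<ge> 1" by (simp_all add: Suc_le_eq card_gt_0_iff)
    then show ?thesis by simp
  qed
  ultimately have mp: "minimal_pair D {w} {y}" using D unfolding minimal_pair_def by blast
  obtain q f' where q: "q \<in> V" "q \<noteq> y" "q \<noteq> w" and f': "f' \<in> D" "\<Gamma> f' = \<Gamma> (y, w)"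
    and into: "into {y, w, q} = insert f' (A - D)"
    using minimal_closed_pair_singletons[OF mp f] by blast
  show ?thesis
  proof (cases "q = x")
    case True
    have "f' \<in> into {y, w, x}" using into True by auto
    then have "f' = u" using f'(1) by (auto simp: D_def into_def)
    then show ?thesis using f' u by simp
  next
    case False
    \<comment> \<open>In-arcs of \<open>q\<close> belong to \<open>D\<close>, but \<open>f'\<close>
      is the only arc of \<open>D\<close> in \<open>into {y, w, q}\<close>.\<close>
    have "e = f'" if "e \<in> into {q}" for e
    proof -
      have "e \<in> into {y, w, q}" "e \<in> D" using that q False by (auto simp: into_def D_def)
      then show ?thesis using into by auto
    qed
    then have "into {q} \<subseteq> {f'}" by auto
    then have "indeg A q \<le> 1" by (rule indeg_le_1[OF q(1)])
    moreover have "indeg A q \<ge> 2"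
      using delta3_minimal_indeg_ge_2[OF xyw deg q(1)] q False by simp
    ultimately show ?thesis by simp
  qed
qed

lemma opposite_arc_color:
  assumes ext: "extremal x y w c" and u: "u \<in> into {x}" "\<Gamma> u = c"
    and f: "f \<in> A" "f = (y, w) \<or> f = (w, y)"
  shows "\<Gamma> f = c"
proof -
  have "extremal x w y c" using ext extremal_swap extremal_rotate by blast
  then show ?thesis using opposite_arc_color_aux assms by metis
qed

text \<open>If \<open>(v, x)\<close> shared its colour with an arc \<open>b'\<close> outside \<open>into {x, y, w}\<close>, exchanging the two in
  \<open>A - into {x, y, w} \<union> {(y, w)}\<close> would leave disjoint closed sets \<open>P\<close> and \<open>Q\<close>. One of them gives a
  vertex outside \<open>{x, y, w}\<close> of in-degree smaller than that of \<open>w\<close>, or of in-degree at most 1.\<close>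

lemma opposite_vertex_color_aux:
  assumes ext: "extremal x y w c" and u: "(y, w) \<in> A" "\<Gamma> (y, w) = c" and b: "(v, x) \<in> A"
  shows "\<Gamma> (v, x) = c"
proof (rule ccontr)
  assume diff: "\<Gamma> (v, x) \<noteq> c"
  define D where "D = insert (y, w) (A - into {x, y, w})"
  have xyw: "x \<in> V" "y \<in> V" "w \<in> V" "x \<noteq> y" "x \<noteq> w" "y \<noteq> w"
    and deg: "indeg A x + indeg A y + indeg A w = delta3 V A"
    using ext by (auto simp: extremal_def)
  have D: "transversal D" using ext u unfolding extremal_def D_def into_def by fastforce
  have v: "v \<in> V" "v \<noteq> x" "(x, v) \<notin> A" using arc_ends[OF b] not_both[OF b] by auto
  have in_D: "(r, s) \<in> D" if "(r, s) \<in> A" "s \<notin> {x, y, w}" for r s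
    using that by (auto simp: D_def into_def)
  obtain b' where b': "b' \<in> D" "\<Gamma> b' = \<Gamma> (v, x)" using partner[OF D b] .
  have b'_u: "b' \<noteq> (y, w)" using b' diff u by auto
  then have b'_head: "snd b' \<notin> {x, y, w}" using b' by (auto simp: D_def into_def)
  define D' where "D' = insert (v, x) (D - {b'})"
  have D': "transversal D'" unfolding D'_def using transversal_exchange[OF D b b'] .
  obtain P Q where PQ: "closed_pair D' P Q" and head: "snd b' \<notin> P"
    using transversal_closed_pair[OF D'] closed_pair_commute unfolding closed_pair_def
    by (metis disjoint_iff)
  have PQ': "P \<subseteq> V" "Q \<subseteq> V" "P \<noteq> {}" "Q \<noteq> {}" "P \<inter> Q = {}" "in_cut D' P = {}" "in_cut D' Q = {}"
    using PQ by (auto simp: closed_pair_def)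
  have fin: "finite P" "finite Q" using PQ' finite_V finite_subset by blast+
  have P: "r \<in> P" if "(r, s) \<in> D \<or> (r, s) = (v, x)" "s \<in> P" for r s
    using PQ'(6) that head by (force simp: in_cut_def D'_def)
  have Q: "r \<in> Q" if "(r, s) \<in> D \<or> (r, s) = (v, x)" "(r, s) \<noteq> b'" "s \<in> Q" for r s
    using PQ'(7) that by (force simp: in_cut_def D'_def)
  have yw_D: "(y, w) \<in> D" by (simp add: D_def)
  have xy_closed: "in_cut D {x} = {}" "in_cut D {y} = {}"
    using xyw by (auto simp: D_def in_cut_def into_def)
  have indeg_w: "card R \<le> indeg A w" if "\<And>r. r \<in> R \<Longrightarrow> (r, w) \<in> A" for R
    unfolding indeg_def using that finite_V arc_ends
    by (intro card_mono) (auto intro: finite_subset[of _ V])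
  \<comment> \<open>Otherwise \<open>{x}\<close>, \<open>{y}\<close> and \<open>P\<close> would be
    three disjoint closed sets in \<open>D\<close>.\<close>
  have "P \<inter> {x, y} \<noteq> {}"
  proof
    assume "P \<inter> {x, y} = {}"
    moreover have "in_cut D P = {}" using P by (fastforce simp: in_cut_def)
    ultimately show False
      using no_closed_triple[OF D, of "{x}" "{y}" P] xyw PQ' xy_closed by auto
  qed
  \<comment> \<open>If not, \<open>x\<close> and \<open>v\<close> lie in \<open>P\<close> and
    \<open>w\<close> does not. All in-neighbours of \<open>v\<close> lie in
    \<open>P - {x, v}\<close>, while \<open>y\<close> and all of \<open>P - {x}\<close> send arcs to
    \<open>w\<close>. So \<open>v\<close> has smaller in-degree than \<open>w\<close>, against the
    optimality of the triple.\<close>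
  have "y \<in> P"
  proof (rule ccontr)
    assume y: "y \<notin> P"
    then have x: "x \<in> P" using \<open>P \<inter> {x, y} \<noteq> {}\<close> by auto
    have w: "w \<notin> P" using P[of y w] yw_D y by auto
    have vP: "v \<in> P" using P x by blast
    have v_out: "v \<notin> {x, y, w}" using vP v y w by auto
    have "{r. (r, v) \<in> A} \<subseteq> P - {x, v}"
      using P in_D[OF _ v_out] vP v no_loop by blast
    then have "indeg A v \<le> card (P - {x, v})"
      unfolding indeg_def using fin by (intro card_mono) auto
    also have "\<dots> < card P" using fin x by (intro psubset_card_mono) auto
    also have "card P = card (insert y (P - {x}))"
      using fin x y by (metis Diff_iff card.remove card_insert_disjoint finite_Diff)
    also have "\<dots> \<le> indeg A w"
    proof (rule indeg_w)
      fix r assume "r \<in> insert y (P - {x})"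
      then consider "r = y" | "r \<in> P" "r \<notin> {x, y, w}" using y w by auto
      then show "(r, w) \<in> A"
      proof cases
        case 2
        then have "(w, r) \<notin> A" using P in_D w by blast
        then show ?thesis using arc_or_arc[of r w] 2 PQ'(1) xyw by auto
      qed (use u in simp)
    qed
    finally show False using delta3_minimal_le(3)[OF xyw deg v(1) v_out] by simp
  qed
  then have y: "y \<notin> Q" using PQ' by auto
  have w: "w \<notin> Q" using Q[of y w] yw_D b'_u y by auto
  show False
  proof (cases "x \<in> Q")
    case True
    have "(v, x) \<noteq> b'" using b'_head by auto
    then have vQ: "v \<in> Q" using Q True by blast
    have v_out: "v \<notin> {x, y, w}" using vQ v y w by auto
    let ?Q = "Q - {x}"
    let ?t = "card ?Q"
    have Q_out: "r \<in> V \<and> r \<notin> {x, y, w}" if "r \<in> ?Q" for r using that y w PQ' by auto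
    \<comment> \<open>Only \<open>b'\<close> and arcs from \<open>x\<close> can enter
      \<open>?Q\<close>, and \<open>x\<close> sends no arc to \<open>v\<close>.\<close>
    have "in_cut A ?Q \<subseteq> insert b' (Pair x ` (?Q - {v}))"
    proof
      fix e assume "e \<in> in_cut A ?Q"
      moreover obtain r s where rs: "e = (r, s)" by (rule prod.exhaust)
      ultimately have e: "e = (r, s)" "(r, s) \<in> A" "r \<notin> ?Q" "s \<in> ?Q"
        by (simp_all add: in_cut_def)
      have "(r, s) \<in> D" using in_D[OF e(2)] Q_out[OF e(4)] by blast
      then have "(r, s) = b' \<or> r = x" using Q e(3,4) by blast
      moreover have "s \<noteq> v" if "r = x" using that e(2) v(3) by metis
      ultimately show "e \<in> insert b' (Pair x ` (?Q - {v}))" using e(1,4) by blast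
    qed
    then have "card (in_cut A ?Q) \<le> card (insert b' (Pair x ` (?Q - {v})))"
      using fin by (intro card_mono) auto
    also have "\<dots> \<le> Suc (card (Pair x ` (?Q - {v})))" by (rule card_insert_le_m1) (use fin in auto)
    also have "\<dots> \<le> Suc (card (?Q - {v}))" using fin by (simp add: card_image_le)
    also have "\<dots> = ?t" by (rule card_Suc_Diff1) (use fin vQ v in auto)
    finally have cut: "card (in_cut A ?Q) \<le> ?t" .
    \<comment> \<open>Every vertex of \<open>?Q\<close> except possibly the head of
      \<open>b'\<close> sends an arc to \<open>w\<close>, and \<open>y\<close> makes up for that one
      loss.\<close>
    have "?t \<le> Suc (card (?Q - {snd b'}))"
      using diff_card_le_card_Diff[of "{snd b'}" ?Q] by simp
    also have "\<dots> = card (insert y (?Q - {snd b'}))"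
      by (rule card_insert_disjoint[symmetric]) (use fin y in auto)
    also have "\<dots> \<le> indeg A w"
    proof (rule indeg_w)
      fix r assume "r \<in> insert y (?Q - {snd b'})"
      then have "r = y \<or> r \<in> ?Q \<and> (w, r) \<noteq> b'" by auto
      then consider "r = y" | "r \<in> ?Q" "(w, r) \<noteq> b'" by blast
      then show "(r, w) \<in> A"
      proof cases
        case 2
        then have "(w, r) \<notin> A" using Q[of w r] in_D Q_out[of r] w by blast
        then show ?thesis using arc_or_arc[of r w] Q_out[OF 2(1)] xyw by auto
      qed (use u in simp)
    qed
    finally have t: "?t \<le> indeg A w" .
    \<comment> \<open>Each vertex of \<open>?Q\<close> has in-degree at least 2 and at least that of
      \<open>w\<close>. Against the small cut this gives \<open>2 * max 2 ?t \<le> ?t + 1\<close>,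
      which never holds.\<close>
    have "?t * max 2 ?t = (\<Sum>p\<in>?Q. max 2 ?t)" by simp
    also have "\<dots> \<le> (\<Sum>p\<in>?Q. indeg A p)"
    proof (rule sum_mono)
      fix p assume "p \<in> ?Q"
      with Q_out have "p \<in> V" "p \<notin> {x, y, w}" by auto
      with delta3_minimal_le(3)[OF xyw deg this] delta3_minimal_indeg_ge_2[OF xyw deg this] t
      show "max 2 ?t \<le> indeg A p" by simp
    qed
    finally have "2 * (?t * max 2 ?t) \<le> ?t * (?t - 1) + 2 * ?t"
      using sum_indeg[of ?Q] cut PQ'(2) by (simp add: subset_iff)
    also have "\<dots> = ?t * (?t + 1)" by (cases ?t) auto
    finally have "?t * (2 * max 2 ?t) \<le> ?t * (?t + 1)" by (simp only: mult.left_commute)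
    moreover have "?t > 0" using vQ v fin by (auto simp: card_gt_0_iff)
    ultimately have "2 * max 2 ?t \<le> ?t + 1" using nat_mult_le_cancel1 by blast
    then show False by simp
  next
    case False
    have "in_cut A {x} \<union> in_cut A {y} \<union> in_cut A Q \<subseteq> insert b' (A - D)"
      using xy_closed Q by (fastforce simp: in_cut_def)
    then obtain q where q: "Q = {q}" and into: "into {x, y, q} = insert b' (A - D)"
      using nearly_closed_triple[OF D, of "{x}" "{y}" Q b'] xyw PQ' y False b'(1) by auto
    have q_out: "q \<in> V" "q \<notin> {x, y, w}" using q False y w PQ' by auto
    have "e = b'" if "e \<in> into {q}" for e
    proof -
      have "e \<in> into {x, y, q}" "e \<in> D" using that q_out by (auto simp: into_def D_def)
      then show ?thesis using into by auto
    qed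
    then have "into {q} \<subseteq> {b'}" by auto
    then have "indeg A q \<le> 1" by (rule indeg_le_1[OF q_out(1)])
    then show False using delta3_minimal_indeg_ge_2[OF xyw deg q_out] by simp
  qed
qed

lemma opposite_vertex_color:
  assumes ext: "extremal x y w c"
    and f: "f \<in> A" "f = (y, w) \<or> f = (w, y)" "\<Gamma> f = c" and b: "b \<in> A" "snd b = x"
  shows "\<Gamma> b = c"
proof -
  have "extremal x w y c" using ext extremal_swap extremal_rotate by blast
  then show ?thesis using opposite_vertex_color_aux assms by (metis prod.collapse)
qed

text \<open>The color spreads from \<open>(y, x)\<close> to all in-arcs of the opposite vertex
  \<open>w\<close>, and to the arc between \<open>y\<close> and \<open>w\<close>, hence to the
  in-arcs of \<open>x\<close>. The arc between \<open>x\<close> and \<open>w\<close> enters one of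
  these two, so it has the color as well and passes it to the in-arcs of \<open>y\<close>.\<close>

lemma extremal_structure:
  "\<exists>x\<in>V. \<exists>y\<in>V. \<exists>w\<in>V. x \<noteq> y \<and> x \<noteq> w \<and> y \<noteq> w \<and>
     indeg A x + indeg A y + indeg A w = delta3 V A \<and>
     (\<exists>c. \<forall>a\<in>A. snd a \<in> {x, y, w} \<longrightarrow> \<Gamma> a = c) \<and>
     (\<forall>a\<in>A. snd a \<notin> {x, y, w} \<longrightarrow> (\<forall>b\<in>A. b \<noteq> a \<longrightarrow> \<Gamma> b \<noteq> \<Gamma> a))"
proof -
  obtain x y w c where ext: "extremal x y w c" and yx: "(y, x) \<in> A" "\<Gamma> (y, x) = c"
    using extremal_exists by blast
  have xyw: "x \<in> V" "y \<in> V" "w \<in> V" "x \<noteq> y" "x \<noteq> w" "y \<noteq> w"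
    and deg: "indeg A x + indeg A y + indeg A w = delta3 V A"
    and trans: "\<And>u. u \<in> into {x, y, w} \<Longrightarrow> \<Gamma> u = c \<Longrightarrow> transversal (insert u (A - into {x, y, w}))"
    using ext by (auto simp: extremal_def)
  have ext': "extremal w x y c" "extremal y x w c"
    using ext extremal_swap extremal_rotate by blast+
  have w: "\<Gamma> b = c" if "b \<in> A" "snd b = w" for b
    using opposite_vertex_color[OF ext'(1) yx(1) _ yx(2)] that by blast
  have yx_into: "(y, x) \<in> into {x}" using yx by (simp add: into_def)
  obtain f where f: "f \<in> A" "f = (y, w) \<or> f = (w, y)" using arc_or_arc xyw by blast
  have "\<Gamma> f = c" using opposite_arc_color[OF ext yx_into yx(2) f] .
  then have x: "\<Gamma> b = c" if "b \<in> A" "snd b = x" for b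
    using opposite_vertex_color[OF ext f] that by blast
  obtain g where g: "g \<in> A" "g = (x, w) \<or> g = (w, x)" using arc_or_arc xyw by blast
  have "\<Gamma> g = c" using g w x by auto
  then have y: "\<Gamma> b = c" if "b \<in> A" "snd b = y" for b
    using opposite_vertex_color[OF ext'(2) g] that by blast
  have same: "\<Gamma> a = c" if "a \<in> A" "snd a \<in> {x, y, w}" for a using that x y w by blast
  have inj: "inj_on \<Gamma> (insert (y, x) (A - into {x, y, w}))"
    using trans[of "(y, x)"] yx by (auto simp: into_def transversal_def)
  have "\<Gamma> b \<noteq> \<Gamma> a" if a: "a \<in> A" "snd a \<notin> {x, y, w}" and b: "b \<in> A" "b \<noteq> a" for a b
  proof -
    have a': "a \<in> A - into {x, y, w}" "a \<noteq> (y, x)" using a by (auto simp: into_def)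
    show ?thesis
    proof (cases "snd b \<in> {x, y, w}")
      case True
      then have "\<Gamma> b = \<Gamma> (y, x)" using same b yx by simp
      then show ?thesis using inj_onD[OF inj, of a "(y, x)"] a' by auto
    next
      case False
      then have "b \<in> A - into {x, y, w}" using b by (auto simp: into_def)
      then show ?thesis using inj_onD[OF inj, of b a] a' b by auto
    qed
  qed
  note distinct = this
  show ?thesis
    by (intro bexI[of _ x] bexI[of _ y] bexI[of _ w] conjI exI[of _ c] ballI impI
        xyw deg same distinct) assumption+
qed

end

section \<open>The heterochromatic number\<close>

context finite_tournament
begin

lemma card_A: "card A = card V choose 2"
proof -
  have "A \<inter> V \<times> V = A" using arcs_sub by blast
  then have "2 * card A = card V * (card V - 1)" using card_arcs_within[of V] by simp
  then show ?thesis by (simp add: choose_two)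
qed

lemma delta3_le_card: "delta3 V A \<le> card A"
proof -
  obtain x y w where *: "x \<in> V" "y \<in> V" "w \<in> V" "x \<noteq> y" "x \<noteq> w" "y \<noteq> w"
    and deg: "indeg A x + indeg A y + indeg A w = delta3 V A" by (rule delta3_attained)
  have "card (into {x, y, w}) \<le> card A"
    using finite_A by (intro card_mono) (auto simp: into_def)
  then show ?thesis using card_into_triple[OF *] deg by simp
qed

text \<open>Since \<open>h_num\<close> is a least value, every smaller positive number of colors
  needs a counterexample.\<close>

lemma rainbow_free_coloring_exists:
  assumes k: "k \<ge> 1" "k + delta3 V A \<le> card A + 1"
  shows "\<exists>\<Gamma> :: 'a \<times> 'a \<Rightarrow> nat. card (\<Gamma> ` A) = k \<and> (\<nexists>S. out_tree V A S \<and> heterochromatic \<Gamma> S)"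
proof -
  obtain x y w where *: "x \<in> V" "y \<in> V" "w \<in> V" "x \<noteq> y" "x \<noteq> w" "y \<noteq> w"
    and deg: "indeg A x + indeg A y + indeg A w = delta3 V A" by (rule delta3_attained)
  let ?U = "into {x, y, w}"
  have U: "card ?U = delta3 V A" using card_into_triple[OF *] deg by simp
  have U_sub: "?U \<subseteq> A" by (auto simp: into_def)
  have U_ne: "?U \<noteq> {}" using U delta3_ge_3 by auto
  have R: "card (A - ?U) = card A - delta3 V A"
    using U U_sub finite_into by (simp add: card_Diff_subset)
  obtain h where h: "bij_betw h (A - ?U) {0..<card (A - ?U)}"
    using ex_bij_betw_finite_nat finite_A by blast
  \<comment> \<open>Capping at \<open>k - 1\<close> merges surplus colors so that exactly
    \<open>k\<close> remain; for \<open>k = 1\<close> every arc gets color 0.\<close>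
  define \<Gamma> where "\<Gamma> a = (if a \<in> ?U then 0 else min (Suc (h a)) (k - 1))" for a
  have "\<Gamma> ` A = {..<k}"
  proof (intro equalityI subsetI)
    fix i assume "i \<in> \<Gamma> ` A"
    then show "i \<in> {..<k}" using k by (auto simp: \<Gamma>_def min_def split: if_splits)
  next
    fix i assume i: "i \<in> {..<k}"
    show "i \<in> \<Gamma> ` A"
    proof (cases i)
      case 0
      obtain a where "a \<in> ?U" using U_ne by blast
      then show ?thesis using 0 U_sub by (intro image_eqI[of _ _ a]) (auto simp: \<Gamma>_def)
    next
      case (Suc j)
      then have "j < card (A - ?U)" using i k R by auto
      then have "j \<in> h ` (A - ?U)" using h by (simp add: bij_betw_def)
      then obtain a where "a \<in> A - ?U" "h a = j" by blast
      then show ?thesis using Suc i by (intro image_eqI[of _ _ a]) (auto simp: \<Gamma>_def)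
    qed
  qed
  moreover have "\<not> heterochromatic \<Gamma> S" if S: "out_tree V A S" for S
  proof
    assume inj: "heterochromatic \<Gamma> S"
    obtain r where r: "\<And>v. v \<in> V \<Longrightarrow> v \<noteq> r \<Longrightarrow> \<exists>u. (u, v) \<in> S"
      using out_tree_in_arc[OF S] by blast
    \<comment> \<open>At most one vertex of the triple is the root, so the tree contains in-arcs of
      two others, both of color 0.\<close>
    have "\<exists>p q. p \<in> {x, y, w} \<and> q \<in> {x, y, w} \<and> p \<noteq> q \<and> p \<noteq> r \<and> q \<noteq> r"
      using * by (cases "x = r"; cases "y = r") auto
    then obtain p q where pq: "p \<in> {x, y, w}" "q \<in> {x, y, w}" "p \<noteq> q" "p \<noteq> r" "q \<noteq> r"
      by blast
    then obtain u u' where u: "(u, p) \<in> S" "(u', q) \<in> S" using r * by blast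
    have "S \<subseteq> A" using S by (simp add: out_tree_def)
    then have "(u, p) \<in> ?U" "(u', q) \<in> ?U" using u pq by (auto simp: into_def)
    then have "\<Gamma> (u, p) = \<Gamma> (u', q)" by (simp add: \<Gamma>_def)
    then show False using inj u pq by (auto simp: heterochromatic_def dest: inj_onD)
  qed
  ultimately show ?thesis by (intro exI[of _ \<Gamma>]) auto
qed

lemma h_num_eq: "h_num V A = card A + 2 - delta3 V A"
  unfolding h_num_def
proof (rule Least_equality, intro conjI allI impI)
  show "1 \<le> card A + 2 - delta3 V A" using delta3_le_card by simp
  fix \<Gamma> :: "'a \<times> 'a \<Rightarrow> nat"
  assume card: "card (\<Gamma> ` A) = card A + 2 - delta3 V A"
  show "\<exists>S. out_tree V A S \<and> heterochromatic \<Gamma> S"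
  proof (rule ccontr)
    assume "\<nexists>S. out_tree V A S \<and> heterochromatic \<Gamma> S"
    \<comment> \<open>This coloring has one color more than the locale requires, whereas
      \<open>extremal_exists\<close> forces equality.\<close>
    then interpret rainbow_free_coloring V A \<Gamma> by unfold_locales (use card in auto)
    show False using extremal_exists card delta3_le_card by auto
  qed
next
  fix k
  assume *: "k \<ge> 1 \<and> (\<forall>\<Gamma> :: 'a \<times> 'a \<Rightarrow> nat. card (\<Gamma> ` A) = k \<longrightarrow>
    (\<exists>S. out_tree V A S \<and> heterochromatic \<Gamma> S))"
  then show "card A + 2 - delta3 V A \<le> k"
    using rainbow_free_coloring_exists[of k] by fastforce
qed

end

theorem theorem1:
  fixes V :: "'a set" and A :: "('a \<times> 'a) set"
  assumes "tournament V A" and "card V \<ge> 3"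
  shows "int (h_num V A) = int (card V choose 2) - int (delta3 V A) + 2 \<and>
    (\<forall>\<Gamma> :: ('a \<times> 'a) \<Rightarrow> 'c.
       card (\<Gamma> ` A) = h_num V A - 1 \<and> \<not> (\<exists>S. out_tree V A S \<and> heterochromatic \<Gamma> S) \<longrightarrow>
       (\<exists>x\<in>V. \<exists>y\<in>V. \<exists>w\<in>V. x \<noteq> y \<and> x \<noteq> w \<and> y \<noteq> w \<and>
          indeg A x + indeg A y + indeg A w = delta3 V A \<and>
          (\<exists>c. \<forall>a\<in>A. snd a \<in> {x, y, w} \<longrightarrow> \<Gamma> a = c) \<and>
          (\<forall>a\<in>A. snd a \<notin> {x, y, w} \<longrightarrow> (\<forall>b\<in>A. b \<noteq> a \<longrightarrow> \<Gamma> b \<noteq> \<Gamma> a))))"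
proof -
  interpret finite_tournament V A using assms by unfold_locales
  have h: "h_num V A = card A + 2 - delta3 V A" by (rule h_num_eq)
  have le: "delta3 V A \<le> card A" by (rule delta3_le_card)
  have "int (h_num V A) = int (card V choose 2) - int (delta3 V A) + 2"
    using h le card_A by simp
  moreover have "\<exists>x\<in>V. \<exists>y\<in>V. \<exists>w\<in>V. x \<noteq> y \<and> x \<noteq> w \<and> y \<noteq> w \<and>
      indeg A x + indeg A y + indeg A w = delta3 V A \<and>
      (\<exists>c. \<forall>a\<in>A. snd a \<in> {x, y, w} \<longrightarrow> \<Gamma> a = c) \<and>
      (\<forall>a\<in>A. snd a \<notin> {x, y, w} \<longrightarrow> (\<forall>b\<in>A. b \<noteq> a \<longrightarrow> \<Gamma> b \<noteq> \<Gamma> a))"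
    if "card (\<Gamma> ` A) = h_num V A - 1" "\<nexists>S. out_tree V A S \<and> heterochromatic \<Gamma> S"
    for \<Gamma> :: "'a \<times> 'a \<Rightarrow> 'c"
  proof -
    interpret rainbow_free_coloring V A \<Gamma> by unfold_locales (use that h le in auto)
    show ?thesis by (rule extremal_structure)
  qed
  ultimately show ?thesis by blast
qed

end
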